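(* Let $F$ be a field of characteristic zero and let $E$ be a three-dimensional evolution algebra over $F$ with basis $\{e_1,e_2,e_3\}$ and table of multiplication $$e_1\cdot e_1=a_1e_1+a_2e_2+a_3e_3,\quad e_2\cdot e_2=b_1e_1+b_2e_2+b_3e_3,\quad e_3\cdot e_3=c_1e_1+c_2e_2+c_3e_3,$$ and $e_i\cdot e_j=0$ for $i\neq j$. Suppose that each of the basis elements $e_1,e_2,e_3$ has infinite period and that $a_2a_3b_1b_3c_1c_2=0$. Then there exist scalars $\alpha_2,\alpha_3,\beta_3\in F$ such that $E$ is isomorphic to the evolution algebra $E^1$ with basis $\{f_1,f_2,f_3\}$ and products $$E^1:\quad f_1\cdot f_1=\alpha_2f_2+\alpha_3f_3,\qquad f_2\cdot f_2=\beta_3f_3,$$ all other products of basis elements being zero.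
   Context: An evolution algebra is an algebra with a basis $\{e_i\}$ such that $e_i\cdot e_j=0$ for $i\neq j$. Plenary powers of an element $x$ are defined by $x^{[1]}=x$, $x^{[k+1]}=x^{[k]}\cdot x^{[k]}$ for $k\ge1$. For a basis element $e_j$, write $e_j<x$ if $e_j$ occurs with nonzero coefficient in the expansion of $x$ in the given basis. The period of $e_j$ is defined as the greatest common divisor of $\{\log_2 m \mid e_j<e_j^{[m]}\}$; the period is infinite when $e_j$ never reoccurs, i.e. when for every $k\ge2$ the coefficient of $e_j$ in $e_j^{[k]}$ is zero. *)

theory Defs
  imports "HOL-Analysis.Analysis"
begin

locale nonassoc_algebra = vector_space scale
  for scale :: "'a::field \<Rightarrow> 'b::ab_group_add \<Rightarrow> 'b" (infixr "*\<^sub>E" 75) +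
  fixes mult :: "'b \<Rightarrow> 'b \<Rightarrow> 'b" (infixl "\<cdot>" 70)
  assumes linear_mult_right: "Vector_Spaces.linear (*\<^sub>E) (*\<^sub>E) (\<lambda>y. x \<cdot> y)"
    and linear_mult_left: "Vector_Spaces.linear (*\<^sub>E) (*\<^sub>E) (\<lambda>x. x \<cdot> y)"
begin

text \<open>The index starts at 1; the value at 0 is a dummy.\<close>

fun plenary_power :: "'b \<Rightarrow> nat \<Rightarrow> 'b" where
  "plenary_power x 0 = x"
| "plenary_power x (Suc 0) = x"
| "plenary_power x (Suc (Suc k)) = plenary_power x (Suc k) \<cdot> plenary_power x (Suc k)"

end

definition algebra_isomorphism ::
  "('a::field \<Rightarrow> 'b::ab_group_add \<Rightarrow> 'b) \<Rightarrow> ('b \<Rightarrow> 'b \<Rightarrow> 'b) \<Rightarrow>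
   ('a \<Rightarrow> 'c::ab_group_add \<Rightarrow> 'c) \<Rightarrow> ('c \<Rightarrow> 'c \<Rightarrow> 'c) \<Rightarrow> ('b \<Rightarrow> 'c) \<Rightarrow> bool" where
  "algebra_isomorphism s1 m1 s2 m2 \<phi> \<longleftrightarrow>
     Vector_Spaces.linear s1 s2 \<phi> \<and> bij \<phi> \<and> (\<forall>x y. \<phi> (m1 x y) = m2 (\<phi> x) (\<phi> y))"

definition algebra_isomorphic ::
  "('a::field \<Rightarrow> 'b::ab_group_add \<Rightarrow> 'b) \<Rightarrow> ('b \<Rightarrow> 'b \<Rightarrow> 'b) \<Rightarrow>
   ('a \<Rightarrow> 'c::ab_group_add \<Rightarrow> 'c) \<Rightarrow> ('c \<Rightarrow> 'c \<Rightarrow> 'c) \<Rightarrow> bool" where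
  "algebra_isomorphic s1 m1 s2 m2 \<longleftrightarrow> (\<exists>\<phi>. algebra_isomorphism s1 m1 s2 m2 \<phi>)"

locale evolution_algebra = nonassoc_algebra scale mult
  for scale :: "'a::field \<Rightarrow> 'b::ab_group_add \<Rightarrow> 'b" (infixr "*\<^sub>E" 75)
    and mult :: "'b \<Rightarrow> 'b \<Rightarrow> 'b" (infixl "\<cdot>" 70) +
  fixes e :: "'i \<Rightarrow> 'b"
  assumes inj_basis: "inj e"
    and independent_basis: "independent (range e)"
    and span_basis: "span (range e) = UNIV"
    and mult_basis: "i \<noteq> j \<Longrightarrow> e i \<cdot> e j = 0"
begin

definition occurs :: "'i \<Rightarrow> 'b \<Rightarrow> bool" where
  "occurs j x \<longleftrightarrow> representation (range e) x (e j) \<noteq> 0"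

text \<open>
  The plenary power with index k is a product of \<open>m = 2 ^ (k - 1)\<close> factors, so that
  \<open>log\<^sub>2 m = k - 1\<close>: the period is the gcd of the numbers of squarings after which the
  basis element reoccurs.
\<close>

definition period :: "'i \<Rightarrow> enat" where
  "period j =
     (if \<forall>k\<ge>2. \<not> occurs j (plenary_power (e j) k) then \<infinity>
      else enat (Gcd {k - 1 | k. 2 \<le> k \<and> occurs j (plenary_power (e j) k)}))"

end

text \<open>
  The evolution algebra on the coordinate space with natural basis the unit vectors
  \<open>axis i 1\<close>, where row i of the matrix \<open>A\<close> is the square of the i-th unit vector.
\<close>

definition matrix_mult :: "'a::field ^ 'n ^ 'n \<Rightarrow> 'a ^ 'n \<Rightarrow> 'a ^ 'n \<Rightarrow> 'a ^ 'n" where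
  "matrix_mult A x y = (\<Sum>i\<in>UNIV. (x $ i * y $ i) *s A $ i)"

lemma matrix_mult_axis:
  "matrix_mult A (axis i 1) (axis j 1) = (if i = j then A $ i else 0)"
proof -
  have "matrix_mult A (axis i 1) (axis j 1) =
      (\<Sum>k\<in>UNIV. if k = i then (if i = j then A $ i else 0) else 0)"
    unfolding matrix_mult_def by (rule sum.cong) (auto simp: axis_def)
  then show ?thesis by simp
qed

lemma evolution_algebra_matrix_mult:
  fixes A :: "'a::field ^ 'n ^ 'n"
  shows "evolution_algebra (*s) (matrix_mult A) (\<lambda>i. axis i 1)"
proof -
  have range: "range (\<lambda>i. axis i (1::'a) :: 'a ^ 'n) = cart_basis"
    by (auto simp: cart_basis_def)
  show ?thesis
  proof (intro evolution_algebra.intro nonassoc_algebra.intro nonassoc_algebra_axioms.intro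
      evolution_algebra_axioms.intro)
    show "vector_space ((*s) :: 'a \<Rightarrow> 'a ^ 'n \<Rightarrow> 'a ^ 'n)"
      by (rule vec.vector_space_axioms)
  next
    fix x
    show "Vector_Spaces.linear (*s) (*s) (matrix_mult A x)"
      unfolding matrix_mult_def
      by unfold_locales
        (auto simp: vec_eq_iff algebra_simps sum.distrib sum_distrib_left)
  next
    fix y
    show "Vector_Spaces.linear (*s) (*s) (\<lambda>x. matrix_mult A x y)"
      unfolding matrix_mult_def
      by unfold_locales
        (auto simp: vec_eq_iff algebra_simps sum.distrib sum_distrib_left)
  next
    show "inj (\<lambda>i. axis i (1::'a) :: 'a ^ 'n)"
      by (auto simp: inj_on_def axis_eq_axis)
    show "vec.independent (range (\<lambda>i. axis i (1::'a) :: 'a ^ 'n))"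
      unfolding range by (rule independent_cart_basis)
    show "vec.span (range (\<lambda>i. axis i (1::'a) :: 'a ^ 'n)) = UNIV"
      unfolding range by (rule span_cart_basis)
    show "matrix_mult A (axis i 1) (axis j 1) = 0" if "i \<noteq> j" for i j
      using that by (simp add: matrix_mult_axis)
  qed
qed

definition E1_mult :: "'a::field \<Rightarrow> 'a \<Rightarrow> 'a \<Rightarrow> 'a ^ 3 \<Rightarrow> 'a ^ 3 \<Rightarrow> 'a ^ 3" where
  "E1_mult \<alpha>\<^sub>2 \<alpha>\<^sub>3 \<beta>\<^sub>3 =
     matrix_mult (vector [vector [0, \<alpha>\<^sub>2, \<alpha>\<^sub>3], vector [0, 0, \<beta>\<^sub>3], vector [0, 0, 0]])"

lemma E1_mult_table:
  fixes f :: "3 \<Rightarrow> ('a::field) ^ 3"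
  defines "f \<equiv> \<lambda>i. axis i 1"
  shows "E1_mult \<alpha>\<^sub>2 \<alpha>\<^sub>3 \<beta>\<^sub>3 (f 1) (f 1) = \<alpha>\<^sub>2 *s f 2 + \<alpha>\<^sub>3 *s f 3"
    and "E1_mult \<alpha>\<^sub>2 \<alpha>\<^sub>3 \<beta>\<^sub>3 (f 2) (f 2) = \<beta>\<^sub>3 *s f 3"
    and "E1_mult \<alpha>\<^sub>2 \<alpha>\<^sub>3 \<beta>\<^sub>3 (f 3) (f 3) = 0"
    and "i \<noteq> j \<Longrightarrow> E1_mult \<alpha>\<^sub>2 \<alpha>\<^sub>3 \<beta>\<^sub>3 (f i) (f j) = 0"
  unfolding f_def E1_mult_def matrix_mult_axis
  by (simp_all add: vec_eq_iff forall_3 axis_def)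

end

theory Submission
  imports Defs
begin

text \<open>
  Write \<open>A i j\<close> for the coefficient of \<open>e j\<close> in the square of \<open>e i\<close> and read it as a directed
  graph with an edge from \<open>i\<close> to \<open>j\<close> whenever \<open>A i j \<noteq> 0\<close>. An evolution algebra is determined up to
  isomorphism by \<open>A\<close>, and a permutation of the basis permutes the vertices. The algebras \<open>E\<^sup>1\<close> are
  those whose matrix is strictly upper triangular, and the task is to show that
  the graph has no cycle and to sort its vertices topologically.

  Squaring acts on coordinates by the rule that the \<open>j\<close>-th coordinate of \<open>x \<cdot> x\<close> is the sum of
  \<open>(x i)\<^sup>2 * A i j\<close> over all \<open>i\<close>. Infinite period says that the coefficient of \<open>e i\<close> in every later
  plenary power of \<open>e i\<close> vanishes; the first three squarings yield polynomial equations for the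
  entries of \<open>A\<close>. Each such equation is a sum over the closed walks of a given length, and two
  nonzero terms may cancel, so infinite period alone does not forbid cycles: it holds for
  \<open>e 1 \<cdot> e 1 = e 2 + e 3\<close>, \<open>e 2 \<cdot> e 2 = - e 1 - e 3\<close>, \<open>e 3 \<cdot> e 3 = e 1 - e 2\<close>, where each square
  reproduces itself up to sign when squared.
  This is where the vanishing of one off-diagonal entry \<open>A i j\<close> enters: every 2-cycle and
  every 3-cycle that survives is then the only term of one of the equations, hence absent
  (\<open>no_short_cycles\<close>). The resulting topological order
  (\<open>strictly_triangular_order\<close>) gives the permutation of the basis.
\<close>

section \<open>Coordinates in a finite natural basis\<close>

locale finite_evolution_algebra = evolution_algebra scale mult e
  for scale :: "'a::field \<Rightarrow> 'b::ab_group_add \<Rightarrow> 'b" (infixr "*\<^sub>E" 75)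
    and mult :: "'b \<Rightarrow> 'b \<Rightarrow> 'b" (infixl "\<cdot>" 70)
    and e :: "'i::finite \<Rightarrow> 'b"
begin

definition coord :: "'b \<Rightarrow> 'i \<Rightarrow> 'a" where
  "coord x i = representation (range e) x (e i)"

definition structure_constant :: "'i \<Rightarrow> 'i \<Rightarrow> 'a" where
  "structure_constant i j = coord (e i \<cdot> e i) j"

lemma coord_add [simp]: "coord (x + y) i = coord x i + coord y i"
  by (simp add: coord_def representation_add independent_basis span_basis)

lemma coord_scale [simp]: "coord (c *\<^sub>E x) i = c * coord x i"
  by (simp add: coord_def representation_scale independent_basis span_basis)

lemma coord_zero [simp]: "coord 0 i = 0"
  by (simp add: coord_def representation_zero)

lemma coord_sum [simp]: "coord (sum f S) i = (\<Sum>s\<in>S. coord (f s) i)"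
  by (induction S rule: infinite_finite_induct) simp_all

lemma coord_basis [simp]: "coord (e i) j = (if i = j then 1 else 0)"
  using inj_basis
  by (auto simp: coord_def representation_basis independent_basis inj_eq)

lemma basis_expansion: "(\<Sum>i\<in>UNIV. coord x i *\<^sub>E e i) = x"
proof -
  have "(\<Sum>i\<in>UNIV. coord x i *\<^sub>E e i) = (\<Sum>b\<in>range e. representation (range e) x b *\<^sub>E b)"
    using inj_basis by (simp add: coord_def sum.reindex)
  also have "\<dots> = x"
    by (rule sum_representation_eq) (simp_all add: independent_basis span_basis)
  finally show ?thesis .
qed

lemma coord_mult: "coord (x \<cdot> y) j = (\<Sum>i\<in>UNIV. coord x i * coord y i * structure_constant i j)"
proof -
  interpret left: Vector_Spaces.linear scale scale "\<lambda>w. w \<cdot> z" for z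
    by (rule linear_mult_left)
  interpret right: Vector_Spaces.linear scale scale "\<lambda>w. z \<cdot> w" for z
    by (rule linear_mult_right)
  have right_basis: "e i \<cdot> y = coord y i *\<^sub>E (e i \<cdot> e i)" for i
  proof -
    have "e i \<cdot> y = e i \<cdot> (\<Sum>k\<in>UNIV. coord y k *\<^sub>E e k)"
      by (simp add: basis_expansion)
    also have "\<dots> = (\<Sum>k\<in>UNIV. coord y k *\<^sub>E (e i \<cdot> e k))"
      by (simp add: right.sum right.scale)
    also have "\<dots> = (\<Sum>k\<in>UNIV. if k = i then coord y i *\<^sub>E (e i \<cdot> e i) else 0)"
      by (rule sum.cong) (auto simp: mult_basis)
    finally show ?thesis
      by simp
  qed
  have "x \<cdot> y = (\<Sum>i\<in>UNIV. coord x i *\<^sub>E e i) \<cdot> y"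
    by (simp add: basis_expansion)
  also have "\<dots> = (\<Sum>i\<in>UNIV. coord x i *\<^sub>E coord y i *\<^sub>E (e i \<cdot> e i))"
    by (simp add: left.sum left.scale flip: right_basis)
  finally show ?thesis
    by (simp add: structure_constant_def mult.assoc)
qed

text \<open>
  Taking coordinates is the isomorphism: \<open>coord_mult\<close> is the formula that defines the
  multiplication on the coordinate space.
\<close>

theorem isomorphic_matrix_mult:
  "algebra_isomorphic (*\<^sub>E) (\<cdot>) (*s) (matrix_mult (\<chi> i j. structure_constant i j))"
proof -
  define \<phi> :: "'b \<Rightarrow> 'a ^ 'i" where "\<phi> x = (\<chi> i. coord x i)" for x
  have "Vector_Spaces.linear (*\<^sub>E) (*s) \<phi>"
    by unfold_locales (auto simp: \<phi>_def vec_eq_iff algebra_simps)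
  moreover have "bij \<phi>"
  proof (rule o_bij)
    define \<psi> :: "'a ^ 'i \<Rightarrow> 'b" where "\<psi> v = (\<Sum>i\<in>UNIV. v $ i *\<^sub>E e i)" for v
    show "\<psi> \<circ> \<phi> = id"
      by (auto simp: \<phi>_def \<psi>_def basis_expansion)
    show "\<phi> \<circ> \<psi> = id"
      by (auto simp: \<phi>_def \<psi>_def vec_eq_iff if_distrib cong: if_cong)
  qed
  moreover have "\<phi> (x \<cdot> y) = matrix_mult (\<chi> i j. structure_constant i j) (\<phi> x) (\<phi> y)" for x y
    by (simp add: \<phi>_def vec_eq_iff coord_mult matrix_mult_def)
  ultimately show ?thesis
    unfolding algebra_isomorphic_def algebra_isomorphism_def by blast
qed

lemma reindexed_basis:
  assumes "bij p"
  shows "finite_evolution_algebra (*\<^sub>E) (\<cdot>) (e \<circ> p)"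
proof -
  have "range (e \<circ> p) = range e"
    using assms by (metis bij_def image_comp)
  moreover have "inj (e \<circ> p)"
    using assms inj_basis by (auto simp: bij_def intro: inj_compose)
  moreover have "p i \<noteq> p j" if "i \<noteq> j" for i j
    using assms that by (auto simp: bij_def inj_eq)
  ultimately show ?thesis
    by unfold_locales (simp_all add: independent_basis span_basis mult_basis)
qed

lemma isomorphic_reindexed_matrix_mult:
  assumes "bij p"
  shows "algebra_isomorphic (*\<^sub>E) (\<cdot>) (*s)
    (matrix_mult (\<chi> i j. structure_constant (p i) (p j)))"
proof -
  interpret reindexed: finite_evolution_algebra scale mult "e \<circ> p"
    by (rule reindexed_basis[OF assms])
  have "range (e \<circ> p) = range e"
    using assms by (metis bij_def image_comp)
  then have "reindexed.structure_constant i j = structure_constant (p i) (p j)" for i j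
    unfolding reindexed.structure_constant_def structure_constant_def
      reindexed.coord_def coord_def by simp
  with reindexed.isomorphic_matrix_mult show ?thesis
    by simp
qed

lemma infinite_period_coord:
  assumes "period i = \<infinity>" "2 \<le> k"
  shows "coord (plenary_power (e i) k) i = 0"
  using assms by (auto simp: period_def occurs_def coord_def split: if_splits)

lemma infinite_period_structure_constant:
  assumes "period i = \<infinity>"
  shows "structure_constant i i = 0"
  using infinite_period_coord[OF assms, of 2]
  by (simp add: structure_constant_def numeral_2_eq_2)

end

section \<open>Closed walks on three vertices\<close>

locale three_dim_evolution_algebra = finite_evolution_algebra scale mult e
  for scale :: "'a::field \<Rightarrow> 'b::ab_group_add \<Rightarrow> 'b" (infixr "*\<^sub>E" 75)
    and mult :: "'b \<Rightarrow> 'b \<Rightarrow> 'b" (infixl "\<cdot>" 70)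
    and e :: "3 \<Rightarrow> 'b" +
  assumes infinite_period: "period i = \<infinity>"
begin

abbreviation "A \<equiv> structure_constant"

lemma A_diag [simp]: "A i i = 0"
  by (rule infinite_period_structure_constant[OF infinite_period])

lemma UNIV_distinct:
  fixes i j k :: 3
  assumes "distinct [i, j, k]"
  shows "UNIV = {i, j, k}"
proof (rule sym, rule card_subset_eq)
  show "card {i, j, k} = card (UNIV :: 3 set)"
    using assms by simp
qed simp_all

lemma sum_distinct:
  fixes i j k :: 3
  assumes "distinct [i, j, k]"
  shows "sum f UNIV = f i + f j + f k"
  using assms unfolding UNIV_distinct[OF assms] by (simp add: add.assoc)

lemma coord_second_plenary: "coord (plenary_power (e i) 2) l = A i l"
  by (simp add: structure_constant_def numeral_2_eq_2)

lemma coord_third_plenary: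
  assumes "distinct [i, j, k]"
  shows "coord (plenary_power (e i) 3) l = (A i j)\<^sup>2 * A j l + (A i k)\<^sup>2 * A k l"
proof -
  have "plenary_power (e i) 3 = plenary_power (e i) 2 \<cdot> plenary_power (e i) 2"
    by (simp add: numeral_2_eq_2 numeral_3_eq_3)
  then show ?thesis
    by (simp add: coord_mult sum_distinct[OF assms] coord_second_plenary power2_eq_square)
qed

lemma closed_walks_2:
  assumes "distinct [i, j, k]"
  shows "(A i j)\<^sup>2 * A j i + (A i k)\<^sup>2 * A k i = 0"
  using infinite_period_coord[OF infinite_period, of 3 i]
  by (simp add: coord_third_plenary[OF assms])

text \<open>
  Since the diagonal vanishes, the coordinates of the third plenary power of \<open>e i\<close> at \<open>j\<close> and at
  \<open>k\<close> are single monomials, one for each path of length 2; squaring once more gives one monomial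
  for each of the two 3-cycles, without cross terms.
\<close>

lemma closed_walks_3:
  assumes "distinct [i, j, k]"
  shows "((A i k)\<^sup>2 * A k j)\<^sup>2 * A j i + ((A i j)\<^sup>2 * A j k)\<^sup>2 * A k i = 0"
proof -
  have "plenary_power (e i) 4 = plenary_power (e i) 3 \<cdot> plenary_power (e i) 3"
    by (simp add: numeral_eq_Suc)
  then have "coord (plenary_power (e i) 4) i =
      ((A i k)\<^sup>2 * A k j)\<^sup>2 * A j i + ((A i j)\<^sup>2 * A j k)\<^sup>2 * A k i"
    by (simp add: coord_mult sum_distinct[OF assms] coord_third_plenary[OF assms]
        power2_eq_square)
  then show ?thesis
    using infinite_period_coord[OF infinite_period, of 4 i] by simp
qed

text \<open>
  The missing edge from \<open>i\<close> to \<open>j\<close> destroys the 2-cycle on \<open>i, j\<close> and one of the two 3-cycles. Each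
  equation for closed walks that involved one of these has a single term left, and that term
  is a monomial supported on exactly one of the remaining cycles.
\<close>

lemma no_short_cycles:
  assumes ijk: "distinct [i, j, k]" and missing: "A i j = 0"
  shows "A i k = 0 \<or> A k i = 0"
    and "A j k = 0 \<or> A k j = 0"
    and "A i k = 0 \<or> A k j = 0 \<or> A j i = 0"
proof -
  show "A i k = 0 \<or> A k i = 0"
    using closed_walks_2[OF ijk] missing by simp
  have "distinct [j, i, k]"
    using ijk by auto
  from closed_walks_2[OF this] show "A j k = 0 \<or> A k j = 0"
    using missing by simp
  show "A i k = 0 \<or> A k j = 0 \<or> A j i = 0"
    using closed_walks_3[OF ijk] missing by simp
qed

section \<open>Topological order and normal form\<close>

lemma strictly_triangular_order:
  assumes "i \<noteq> j" and missing: "A i j = 0"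
  obtains r s t where "distinct [r, s, t]" "A s r = 0" "A t r = 0" "A t s = 0"
proof -
  obtain k where k: "k \<notin> {i, j}"
  proof -
    have "card {i, j} < card (UNIV :: 3 set)"
      using \<open>i \<noteq> j\<close> by simp
    then have "{i, j} \<noteq> UNIV"
      by (metis less_irrefl)
    then show ?thesis
      using that by blast
  qed
  then have ijk: "distinct [i, j, k]"
    using \<open>i \<noteq> j\<close> by auto
  note cycles = no_short_cycles[OF ijk missing]
  (* In the three cases the sink, which comes last, is i, k and j respectively. *)
  consider "A i k = 0" | "A k i = 0" "A k j = 0" | "A i k \<noteq> 0" "A k j \<noteq> 0"
    using cycles(1) by blast
  then show thesis
  proof cases
    case 1
    then show ?thesis
      using cycles(2) missing ijk that[of j k i] that[of k j i] by auto
  next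
    case 2
    then show ?thesis
      using missing ijk that[of j i k] by auto
  next
    case 3
    then show ?thesis
      using cycles ijk that[of i k j] by auto
  qed
qed

text \<open>
  A topological order, read as a permutation of the basis, makes the structure matrix strictly
  upper triangular, which is the shape of the matrix defining \<^const>\<open>E1_mult\<close>.
\<close>

theorem isomorphic_E1:
  assumes "i \<noteq> j" and "A i j = 0"
  shows "\<exists>\<alpha>\<^sub>2 \<alpha>\<^sub>3 \<beta>\<^sub>3. algebra_isomorphic (*\<^sub>E) (\<cdot>) (*s) (E1_mult \<alpha>\<^sub>2 \<alpha>\<^sub>3 \<beta>\<^sub>3)"
proof -
  from assms obtain r s t where
    rst: "distinct [r, s, t]" and zero: "A s r = 0" "A t r = 0" "A t s = 0"
    by (rule strictly_triangular_order)
  define p :: "3 \<Rightarrow> 3" where "p n = (if n = 1 then r else if n = 2 then s else t)" for n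
  have p: "p 1 = r" "p 2 = s" "p 3 = t"
    by (simp_all add: p_def)
  have "surj p"
    using UNIV_distinct[OF rst] by (auto simp flip: p)
  then have "bij p"
    by (simp add: bij_def finite_UNIV_surj_inj)
  moreover have "(\<chi> m n. A (p m) (p n)) =
      vector [vector [0, A r s, A r t], vector [0, 0, A s t], vector [0, 0, 0]]"
    by (simp add: vec_eq_iff forall_3 p zero)
  ultimately show ?thesis
    unfolding E1_mult_def using isomorphic_reindexed_matrix_mult by metis
qed

end

theorem theorem5p1:
  fixes scale :: "'a::field_char_0 \<Rightarrow> 'b::ab_group_add \<Rightarrow> 'b" (infixr "*\<^sub>E" 75)
    and mult :: "'b \<Rightarrow> 'b \<Rightarrow> 'b" (infixl "\<cdot>" 70)
    and e :: "3 \<Rightarrow> 'b"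
    and a\<^sub>1 a\<^sub>2 a\<^sub>3 b\<^sub>1 b\<^sub>2 b\<^sub>3 c\<^sub>1 c\<^sub>2 c\<^sub>3 :: 'a
  assumes "evolution_algebra (*\<^sub>E) (\<cdot>) e"
    and "e 1 \<cdot> e 1 = a\<^sub>1 *\<^sub>E e 1 + a\<^sub>2 *\<^sub>E e 2 + a\<^sub>3 *\<^sub>E e 3"
    and "e 2 \<cdot> e 2 = b\<^sub>1 *\<^sub>E e 1 + b\<^sub>2 *\<^sub>E e 2 + b\<^sub>3 *\<^sub>E e 3"
    and "e 3 \<cdot> e 3 = c\<^sub>1 *\<^sub>E e 1 + c\<^sub>2 *\<^sub>E e 2 + c\<^sub>3 *\<^sub>E e 3"
    and "\<forall>j. evolution_algebra.period (*\<^sub>E) (\<cdot>) e j = \<infinity>"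
    and "a\<^sub>2 * a\<^sub>3 * b\<^sub>1 * b\<^sub>3 * c\<^sub>1 * c\<^sub>2 = 0"
  shows "\<exists>\<alpha>\<^sub>2 \<alpha>\<^sub>3 \<beta>\<^sub>3 :: 'a. algebra_isomorphic (*\<^sub>E) (\<cdot>) (*s) (E1_mult \<alpha>\<^sub>2 \<alpha>\<^sub>3 \<beta>\<^sub>3)"
proof -
  interpret evolution_algebra scale mult e
    by fact
  interpret three_dim_evolution_algebra scale mult e
    using assms(5) by unfold_locales auto
  have table: "A 1 2 = a\<^sub>2" "A 1 3 = a\<^sub>3" "A 2 1 = b\<^sub>1" "A 2 3 = b\<^sub>3" "A 3 1 = c\<^sub>1" "A 3 2 = c\<^sub>2"
    by (simp_all add: structure_constant_def assms(2-4))
  from assms(6) have "A 1 2 = 0 \<or> A 1 3 = 0 \<or> A 2 1 = 0 \<or> A 2 3 = 0 \<or> A 3 1 = 0 \<or> A 3 2 = 0"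
    unfolding table by auto
  then obtain i j where "i \<noteq> j" "A i j = 0"
    by (elim disjE) (rule that; simp)+
  then show ?thesis
    by (rule isomorphic_E1)
qed

end
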